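(* Let $X$ be a complex Banach space, let $T:D(T)\subset X\to X$ be a closed linear operator with nonempty resolvent set, and let $\lambda$ be an isolated point of its spectrum $\sigma(T)$. Then $\lambda\in\sigma_{bd}(T)$ if and only if $T-\lambda I$ is a B-Fredholm operator.
   Context: For a closed linear operator $T:D(T)\subset X\to X$, write $N(T)$, $R(T)$ for its nullspace and range and $\sigma(T)$ for its spectrum. Ascent: $a(T)=\inf\{n\in\mathbb N: N(T^n)=N(T^{n+1})\}$; descent: $\delta(T)=\inf\{n\in\mathbb N: R(T^n)=R(T^{n+1})\}$ (with $\inf\emptyset=\infty$, $\mathbb N=\{0,1,2,\dots\}$, and $T^n$ defined on its natural domain). $T$ is Drazin invertible if $a(T)$ and $\delta(T)$ are both finite. The Drazin spectrum is $\sigma_{D}(T)=\{\lambda\in\mathbb C: T-\lambda I\text{ is not Drazin invertible}\}$, and the B-discrete spectrum is $\sigma_{bd}(T)=\sigma(T)\setminus\sigma_D(T)$. A closed operator is Fredholm if its nullspace has finite dimension and its range has finite codimension. A closed operator $T$ is B-Fredholm if there is an integer $n\ge 0$ such that $R(T^n)$ is closed and the restriction $T_{[n]}: D(T)\cap R(T^n)\to R(T^n)$ of $T$, viewed as an operator from $R(T^n)$ to $R(T^n)$, is Fredholm. *)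

theory Defs
  imports "HOL-Analysis.Analysis"
begin

class complex_banach = banach +
  fixes scaleC :: "complex \<Rightarrow> 'a \<Rightarrow> 'a" (infixr "*\<^sub>C" 75)
  assumes scaleC_add_right: "a *\<^sub>C (x + y) = a *\<^sub>C x + a *\<^sub>C y"
    and scaleC_add_left: "(a + b) *\<^sub>C x = a *\<^sub>C x + b *\<^sub>C x"
    and scaleC_scaleC: "a *\<^sub>C b *\<^sub>C x = (a * b) *\<^sub>C x"
    and scaleC_of_real: "complex_of_real r *\<^sub>C x = r *\<^sub>R x"
    and norm_scaleC: "norm (a *\<^sub>C x) = cmod a * norm x"

lemma scaleC_one: "1 *\<^sub>C x = (x :: 'a :: complex_banach)"
  using scaleC_of_real[of 1 x] by simp

instantiation complex :: complex_banach
begin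

definition scaleC_complex :: "complex \<Rightarrow> complex \<Rightarrow> complex" where
  "scaleC_complex a x = a * x"

instance
  by standard
    (simp_all add: scaleC_complex_def algebra_simps norm_mult scaleR_conv_of_real)

end

global_interpretation complex_vector:
    vector_space "scaleC :: complex \<Rightarrow> 'a \<Rightarrow> 'a :: complex_banach"
  defines csubspace = complex_vector.subspace
    and cspan = complex_vector.span
  by unfold_locales
    (simp_all add: scaleC_add_right scaleC_add_left scaleC_scaleC scaleC_one)

text \<open>
  A linear operator on a subspace \<open>M\<close> of the ambient Banach space is given by its domain
  \<open>D \<subseteq> M\<close> together with a total function \<open>T\<close>. The values of \<open>T\<close> outside \<open>D\<close> are junk, so every
  notion below must depend on \<open>T\<close> only through its values on \<open>D\<close>.
\<close>

definition linear_operator_on ::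
    "'a :: complex_banach set \<Rightarrow> 'a set \<Rightarrow> ('a \<Rightarrow> 'a) \<Rightarrow> bool" where
  "linear_operator_on M D T \<longleftrightarrow>
     csubspace M \<and> csubspace D \<and> D \<subseteq> M \<and> T ` D \<subseteq> M \<and>
     (\<forall>x\<in>D. \<forall>y\<in>D. T (x + y) = T x + T y) \<and>
     (\<forall>c. \<forall>x\<in>D. T (c *\<^sub>C x) = c *\<^sub>C T x)"

definition closed_operator_on ::
    "'a :: complex_banach set \<Rightarrow> 'a set \<Rightarrow> ('a \<Rightarrow> 'a) \<Rightarrow> bool" where
  "closed_operator_on M D T \<longleftrightarrow>
     linear_operator_on M D T \<and>
     closedin (top_of_set (M \<times> M)) ((\<lambda>x. (x, T x)) ` D)"

abbreviation closed_operator :: "'a :: complex_banach set \<Rightarrow> ('a \<Rightarrow> 'a) \<Rightarrow> bool" where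
  "closed_operator \<equiv> closed_operator_on UNIV"

definition nullspace :: "'a :: complex_banach set \<Rightarrow> ('a \<Rightarrow> 'a) \<Rightarrow> 'a set" where
  "nullspace D T = {x \<in> D. T x = 0}"

text \<open>
  The natural domain of \<open>T\<^sup>n\<close>: all iterates needed to form \<open>T\<^sup>n x\<close> lie in \<open>D\<close>. On it, \<open>T\<^sup>n\<close> is
  the iterate \<open>T ^^ n\<close> of the total function; the range of \<open>T\<^sup>n\<close> is the image of this domain.
\<close>

definition power_domain :: "'a set \<Rightarrow> ('a \<Rightarrow> 'a) \<Rightarrow> nat \<Rightarrow> 'a set" where
  "power_domain D T n = {x. \<forall>k<n. (T ^^ k) x \<in> D}"

definition power_nullspace ::
    "'a :: complex_banach set \<Rightarrow> ('a \<Rightarrow> 'a) \<Rightarrow> nat \<Rightarrow> 'a set" where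
  "power_nullspace D T n = nullspace (power_domain D T n) (T ^^ n)"

definition power_range :: "'a set \<Rightarrow> ('a \<Rightarrow> 'a) \<Rightarrow> nat \<Rightarrow> 'a set" where
  "power_range D T n = (T ^^ n) ` power_domain D T n"

text \<open>
  For closed \<open>T\<close> the bound on the inverse of \<open>T - \<mu>I\<close> follows from bijectivity.
\<close>

definition resolvent_set :: "'a :: complex_banach set \<Rightarrow> ('a \<Rightarrow> 'a) \<Rightarrow> complex set" where
  "resolvent_set D T =
     {\<mu>. bij_betw (\<lambda>x. T x - \<mu> *\<^sub>C x) D UNIV \<and>
         (\<exists>C. \<forall>x\<in>D. norm x \<le> C * norm (T x - \<mu> *\<^sub>C x))}"

definition spectrum :: "'a :: complex_banach set \<Rightarrow> ('a \<Rightarrow> 'a) \<Rightarrow> complex set" where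
  "spectrum D T = - resolvent_set D T"

definition ascent :: "'a :: complex_banach set \<Rightarrow> ('a \<Rightarrow> 'a) \<Rightarrow> enat" where
  "ascent D T = Inf {enat n | n. power_nullspace D T n = power_nullspace D T (Suc n)}"

definition descent :: "'a set \<Rightarrow> ('a \<Rightarrow> 'a) \<Rightarrow> enat" where
  "descent D T = Inf {enat n | n. power_range D T n = power_range D T (Suc n)}"

definition drazin_invertible :: "'a :: complex_banach set \<Rightarrow> ('a \<Rightarrow> 'a) \<Rightarrow> bool" where
  "drazin_invertible D T \<longleftrightarrow> ascent D T \<noteq> \<infinity> \<and> descent D T \<noteq> \<infinity>"

definition drazin_spectrum :: "'a :: complex_banach set \<Rightarrow> ('a \<Rightarrow> 'a) \<Rightarrow> complex set" where
  "drazin_spectrum D T = {\<mu>. \<not> drazin_invertible D (\<lambda>x. T x - \<mu> *\<^sub>C x)}"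

definition b_discrete_spectrum :: "'a :: complex_banach set \<Rightarrow> ('a \<Rightarrow> 'a) \<Rightarrow> complex set" where
  "b_discrete_spectrum D T = spectrum D T - drazin_spectrum D T"

definition finite_dim :: "'a :: complex_banach set \<Rightarrow> bool" where
  "finite_dim V \<longleftrightarrow> (\<exists>B. finite B \<and> cspan B = V)"

text \<open>
  For a subspace \<open>R\<close> of \<open>M\<close>: the classes of the vectors of some finite \<open>B \<subseteq> M\<close> span \<open>M / R\<close>.
\<close>

definition finite_codim_in :: "'a :: complex_banach set \<Rightarrow> 'a set \<Rightarrow> bool" where
  "finite_codim_in M R \<longleftrightarrow>
     (\<exists>B. finite B \<and> B \<subseteq> M \<and> (\<forall>x\<in>M. \<exists>y\<in>cspan B. x - y \<in> R))"

definition fredholm_on ::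
    "'a :: complex_banach set \<Rightarrow> 'a set \<Rightarrow> ('a \<Rightarrow> 'a) \<Rightarrow> bool" where
  "fredholm_on M D T \<longleftrightarrow>
     closed_operator_on M D T \<and> finite_dim (nullspace D T) \<and> finite_codim_in M (T ` D)"

definition b_fredholm :: "'a :: complex_banach set \<Rightarrow> ('a \<Rightarrow> 'a) \<Rightarrow> bool" where
  "b_fredholm D T \<longleftrightarrow>
     closed_operator D T \<and>
     (\<exists>n. closed (power_range D T n) \<and>
          fredholm_on (power_range D T n) (D \<inter> power_range D T n) T)"

end

theory Submission
  imports Defs
begin

text \<open>
  Put \<open>S = T - \<mu>\<close> and \<open>c = \<nu> - \<mu>\<close> for a point \<open>\<nu>\<close> of the resolvent set. The bounded operator
  \<open>B = S (S - c)\<^sup>-\<^sup>1\<close> has the same iterated ranges and nullspaces as \<open>S\<close>, and \<open>B - t\<close> is bijective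
  for all small \<open>t \<noteq> 0\<close> because \<open>\<mu>\<close> is isolated in the spectrum. If ascent and descent are finite,
  then for large \<open>n\<close> the space is the direct sum of \<open>R(B\<^sup>n)\<close> and \<open>N(B\<^sup>n)\<close>, so \<open>R(B\<^sup>n)\<close> is closed by
  the open mapping theorem, and \<open>B\<close> is bijective on it. Conversely, let \<open>B\<close> be Fredholm on a closed
  \<open>R(B\<^sup>n)\<close>. All further ranges are closed, and \<open>B\<close> maps their intersection \<open>R\<close> onto itself. A kernel
  vector of \<open>B\<close> in \<open>R\<close> would extend to eigenvectors for all small eigenvalues, hence
  \<open>N(B) \<inter> R = 0\<close>, and by finite dimension already \<open>N(B) \<inter> R(B\<^sup>k) = 0\<close> for some \<open>k\<close>: the ascent is
  finite. On \<open>R(B\<^sup>k)\<close> the operator \<open>B\<close> is then bounded below and a limit of surjective operators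
  \<open>B - t\<close>, hence surjective: the descent is finite.
\<close>

section \<open>The open mapping theorem and closed ranges\<close>

text \<open>Baire category in the closed, hence complete, image of \<open>M\<close>: the closures of
  the images of growing balls cover it, so one of them has interior. Subtracting approximants of two
  points near the same interior point moves the estimate to the origin.\<close>

lemma half_approximate_preimage:
  fixes f :: "'a::banach \<Rightarrow> 'b::banach"
  assumes f: "bounded_linear f" and M: "subspace M" and Y: "closed (f ` M)"
  obtains K where "K > 0"
    and "\<And>y. y \<in> f ` M \<Longrightarrow> \<exists>x\<in>M. norm x \<le> K * norm y \<and> norm (y - f x) \<le> norm y / 2"
proof -
  interpret f: bounded_linear f by (rule f)
  define Y where "Y = f ` M"
  define F where "F n = closure (f ` (M \<inter> ball 0 (real n)))" for n
  have subY: "subspace Y" unfolding Y_def by (simp add: M f.linear_axioms linear_subspace_image)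
  have FY: "F n \<subseteq> Y" for n unfolding F_def Y_def by (intro closure_minimal Y) auto
  have cov: "Y = \<Union>(range F)"
  proof
    show "Y \<subseteq> \<Union>(range F)"
    proof
      fix y assume "y \<in> Y"
      then obtain x where x: "x \<in> M" "y = f x" by (auto simp: Y_def)
      obtain n where "norm x < real n" using reals_Archimedean2 by blast
      with x have "y \<in> f ` (M \<inter> ball 0 (real n))" by (auto simp: dist_norm)
      then have "y \<in> F n" unfolding F_def by (rule subsetD[OF closure_subset])
      then show "y \<in> \<Union>(range F)" by blast
    qed
  qed (use FY in blast)
  have "\<exists>n. top_of_set Y interior_of F n \<noteq> {}"
  proof (rule ccontr)
    assume none: "\<not> ?thesis"
    have "top_of_set Y interior_of \<Union>(range F) = {}"
    proof (rule Baire_category_alt)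
      show "completely_metrizable_space (top_of_set Y) \<or>
          locally_compact_space (top_of_set Y) \<and> regular_space (top_of_set Y)"
        using Y completely_metrizable_space_closedin[OF completely_metrizable_space_euclidean]
        by (auto simp: Y_def)
      show "countable (range F)" by simp
      fix T assume "T \<in> range F"
      then show "closedin (top_of_set Y) T \<and> top_of_set Y interior_of T = {}"
        using none FY unfolding F_def by (auto intro!: closed_subset)
    qed
    moreover have "top_of_set Y interior_of Y = Y"
      using interior_of_topspace[of "top_of_set Y"] by simp
    moreover have "0 \<in> Y" using subY by (rule subspace_0)
    ultimately show False using cov by auto
  qed
  then obtain n y0 T where T: "openin (top_of_set Y) T" "T \<subseteq> F n" "y0 \<in> T"
    unfolding interior_of_def by auto
  then obtain r where r: "r > 0" "\<And>y. y \<in> Y \<Longrightarrow> dist y y0 < r \<Longrightarrow> y \<in> F n"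
    unfolding openin_euclidean_subtopology_iff by (metis subsetD)
  have y0: "y0 \<in> Y" using T FY by auto
  \<comment> \<open>Rescaling \<open>x1 - x2\<close> by \<open>1 / s\<close> gives norm at most
    \<open>4 * n / r * norm y\<close>; the summand 1 makes \<open>K\<close> positive without a case
    distinction on \<open>n\<close>.\<close>
  define K where "K = 4 * real n / r + 1"
  have "\<exists>x\<in>M. norm x \<le> K * norm y \<and> norm (y - f x) \<le> norm y / 2" if y: "y \<in> f ` M" for y
  proof (cases "y = 0")
    case True
    then show ?thesis by (intro bexI[of _ 0]) (auto simp: subspace_0[OF M])
  next
    case False
    define s where "s = r / (2 * norm y)"
    have s: "s > 0" using r False by (simp add: s_def)
    define z where "z = y0 + s *\<^sub>R y"
    have "z \<in> Y" unfolding z_def using y0 y subY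
      by (auto simp: Y_def[symmetric] intro!: subspace_add subspace_scale)
    moreover have "dist z y0 < r" using s r False by (simp add: z_def dist_norm s_def)
    ultimately have "z \<in> F n" by (rule r(2))
    moreover have "y0 \<in> F n" using r y0 by auto
    \<comment> \<open>Two errors of \<open>r / 8\<close>, divided by \<open>s\<close>, add up to at
      most \<open>norm y / 2\<close>.\<close>
    moreover have "\<exists>x\<in>M. norm x < n \<and> dist (f x) w < r / 8" if "w \<in> F n" for w
      using that r(1) unfolding F_def closure_approachable
      by (auto dest!: spec[of _ "r / 8"])
    ultimately obtain x1 x2 where x: "x1 \<in> M" "norm x1 < n" "dist (f x1) z < r / 8"
      "x2 \<in> M" "norm x2 < n" "dist (f x2) y0 < r / 8"
      by meson
    define x where "x = (1 / s) *\<^sub>R (x1 - x2)"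
    have "x \<in> M" unfolding x_def using x M by (intro subspace_scale subspace_diff)
    moreover have "norm x \<le> K * norm y"
    proof -
      have "norm x = norm (x1 - x2) / s" using s by (simp add: x_def)
      also have "\<dots> \<le> (real n + real n) / s"
        using x s norm_triangle_ineq4[of x1 x2] by (intro divide_right_mono) auto
      also have "\<dots> \<le> K * norm y" using r False by (simp add: s_def K_def field_simps)
      finally show ?thesis .
    qed
    moreover have "norm (y - f x) \<le> norm y / 2"
    proof -
      have "y - f x = (1 / s) *\<^sub>R ((z - f x1) + (f x2 - y0))"
        using s by (simp add: x_def z_def f.scaleR f.diff algebra_simps)
      then have "norm (y - f x) = norm ((z - f x1) + (f x2 - y0)) / s" using s by simp
      also have "\<dots> \<le> (r / 8 + r / 8) / s"
        using x s norm_triangle_ineq[of "z - f x1" "f x2 - y0"]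
        by (intro divide_right_mono) (auto simp: dist_norm norm_minus_commute)
      also have "\<dots> = norm y / 2" using r False by (simp add: s_def field_simps)
      finally show ?thesis .
    qed
    ultimately show ?thesis by blast
  qed
  moreover have "K > 0" using r by (simp add: K_def add_nonneg_pos)
  ultimately show thesis using that by blast
qed

text \<open>Iterating the half-approximation leaves residuals bounded by a geometric sequence. The
  corrections sum to an exact preimage, which stays in \<open>M\<close> since \<open>M\<close> is
  closed; the geometric series doubles the constant.\<close>

theorem open_mapping:
  fixes f :: "'a::banach \<Rightarrow> 'b::banach"
  assumes f: "bounded_linear f" and M: "subspace M" "closed M" and Y: "closed (f ` M)"
  obtains C where "C > 0" and "\<And>y. y \<in> f ` M \<Longrightarrow> \<exists>x\<in>M. f x = y \<and> norm x \<le> C * norm y"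
proof -
  interpret f: bounded_linear f by (rule f)
  obtain K where K: "K > 0"
    and half: "\<And>y. y \<in> f ` M \<Longrightarrow> \<exists>x\<in>M. norm x \<le> K * norm y \<and> norm (y - f x) \<le> norm y / 2"
    using half_approximate_preimage[OF f M(1) Y] by blast
  obtain g where g: "\<And>y. y \<in> f ` M \<Longrightarrow> g y \<in> M \<and> norm (g y) \<le> K * norm y \<and> norm (y - f (g y)) \<le> norm y / 2"
    using bchoice[of "f ` M" "\<lambda>y x. x \<in> M \<and> norm x \<le> K * norm y \<and> norm (y - f x) \<le> norm y / 2"] half
    by blast
  have subY: "subspace (f ` M)" by (simp add: M f.linear_axioms linear_subspace_image)
  have "\<exists>x\<in>M. f x = y \<and> norm x \<le> (2 * K) * norm y" if y: "y \<in> f ` M" for y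
  proof -
    define u where "u j = ((\<lambda>y. y - f (g y)) ^^ j) y" for j
    have u0: "u 0 = y" and uS: "u (Suc j) = u j - f (g (u j))" for j by (simp_all add: u_def)
    have uY: "u j \<in> f ` M" for j
      by (induction j) (auto simp: u0 uS y g intro!: subspace_diff[OF subY])
    have nu: "norm (u j) \<le> norm y * (1/2)^j" for j
    proof (induction j)
      case (Suc j)
      have "norm (u (Suc j)) \<le> norm (u j) / 2" using g[OF uY] by (simp add: uS)
      also have "\<dots> \<le> norm y * (1/2)^Suc j" using Suc by simp
      finally show ?case .
    qed (simp add: u0)
    have ng: "norm (g (u j)) \<le> K * norm y * (1/2)^j" for j
    proof -
      have "norm (g (u j)) \<le> K * norm (u j)" using g uY by blast
      also have "\<dots> \<le> K * norm y * (1/2)^j" using nu[of j] K by (simp add: mult.assoc)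
      finally show ?thesis .
    qed
    have geo: "(\<lambda>j. K * norm y * (1/2)^j) sums (K * norm y * 2)"
      using sums_mult[OF geometric_sums[of "1/2::real"]] by fastforce
    have sn: "summable (\<lambda>j. norm (g (u j)))"
      by (rule summable_comparison_test'[OF sums_summable[OF geo]]) (use ng in simp)
    then have sg: "(\<lambda>j. g (u j)) sums (\<Sum>j. g (u j))"
      by (rule summable_sums[OF summable_norm_cancel])
    define x where "x = (\<Sum>j. g (u j))"
    have "x \<in> M" unfolding x_def
    proof (rule closed_sequentially[OF M(2)])
      show "(\<lambda>n. \<Sum>j<n. g (u j)) \<longlonglongrightarrow> (\<Sum>j. g (u j))" using sg by (simp add: sums_def)
      show "(\<Sum>j<n. g (u j)) \<in> M" for n using g uY by (intro subspace_sum[OF M(1)]) auto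
    qed
    moreover have "f x = y"
    proof (rule LIMSEQ_unique)
      show "(\<lambda>n. f (\<Sum>j<n. g (u j))) \<longlonglongrightarrow> f x"
        using sg unfolding x_def sums_def by (rule f.tendsto)
      have part: "f (\<Sum>j<n. g (u j)) = y - u n" for n
        by (induction n) (simp_all add: u0 uS f.add f.zero)
      have "(\<lambda>n. norm y * (1/2)^n) \<longlonglongrightarrow> norm y * 0"
        by (intro tendsto_mult tendsto_const LIMSEQ_realpow_zero) auto
      then have "u \<longlonglongrightarrow> 0" using nu
        by (intro Lim_null_comparison[of u "\<lambda>n. norm y * (1/2)^n"]) auto
      then have "(\<lambda>n. y - u n) \<longlonglongrightarrow> y - 0" by (intro tendsto_diff tendsto_const)
      then show "(\<lambda>n. f (\<Sum>j<n. g (u j))) \<longlonglongrightarrow> y" by (simp add: part)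
    qed
    moreover have "norm x \<le> 2 * K * norm y"
    proof -
      have "norm x \<le> (\<Sum>j. norm (g (u j)))" unfolding x_def using sn by (rule summable_norm)
      also have "\<dots> \<le> (\<Sum>j. K * norm y * (1/2)^j)"
        by (rule suminf_le[OF ng sn sums_summable[OF geo]])
      also have "\<dots> = 2 * K * norm y" using sums_unique[OF geo] by simp
      finally show ?thesis .
    qed
    ultimately show ?thesis by blast
  qed
  then show thesis using K by (intro that[of "2 * K"]) auto
qed

text \<open>Kato's criterion: the component in \<open>F\<close> is controlled by applying the open mapping
  theorem to \<open>(x, z) \<mapsto> f x + z\<close>.\<close>

lemma closed_image_if_closed_complement:
  fixes f :: "'a::banach \<Rightarrow> 'b::banach"
  assumes f: "bounded_linear f" and M: "subspace M" "closed M" and F: "subspace F" "closed F"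
    and direct: "f ` M \<inter> F \<subseteq> {0}" and closed_sum: "closed {y + z | y z. y \<in> f ` M \<and> z \<in> F}"
  shows "closed (f ` M)"
proof -
  interpret f: bounded_linear f by (rule f)
  define h where "h p = f (fst p) + snd p" for p
  have h: "bounded_linear h" unfolding h_def
    by (intro bounded_linear_add bounded_linear_compose[OF f] bounded_linear_fst bounded_linear_snd)
  have hM: "h ` (M \<times> F) = {y + z | y z. y \<in> f ` M \<and> z \<in> F}"
    unfolding h_def by (auto simp: image_iff) (metis, blast)
  obtain C where C: "C > 0"
    "\<And>y. y \<in> h ` (M \<times> F) \<Longrightarrow> \<exists>p\<in>M \<times> F. h p = y \<and> norm p \<le> C * norm y"
    using open_mapping[OF h subspace_Times[OF M(1) F(1)] closed_Times[OF M(2) F(2)]] closed_sum hM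
    by metis
  have subY: "subspace (f ` M)" by (simp add: M f.linear_axioms linear_subspace_image)
  show ?thesis
    unfolding closed_sequential_limits
  proof safe
    fix y l assume "\<forall>n. y n \<in> f ` M" and lim: "y \<longlonglongrightarrow> l"
    then have y: "y n \<in> f ` M" for n by blast
    have "y n \<in> h ` (M \<times> F)" for n unfolding hM using y[of n] subspace_0[OF F(1)] by force
    then have "l \<in> h ` (M \<times> F)" using lim closed_sum unfolding hM[symmetric]
      by (meson closed_sequentially)
    then obtain x z where l: "l = f x + z" "x \<in> M" "z \<in> F" unfolding h_def by auto
    \<comment> \<open>If this bound holds for all \<open>n\<close>, convergence of \<open>y\<close>
      to \<open>l\<close> forces \<open>z = 0\<close>, so \<open>l\<close> lies in the
      image.\<close>
    have "norm z \<le> C * norm (y n - l)" for n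
    proof -
      obtain v where v: "v \<in> M" "y n = f v" using y[of n] by blast
      have eq: "y n - l = h (v - x, - z)" by (simp add: h_def v l f.diff)
      moreover have "(v - x, - z) \<in> M \<times> F"
        using v l M F by (simp add: subspace_diff subspace_neg)
      ultimately obtain a b where ab: "a \<in> M" "b \<in> F" "h (a, b) = y n - l"
        "norm (a, b) \<le> C * norm (y n - l)" using C(2)[of "y n - l"] by auto
      \<comment> \<open>The two representations of \<open>y n - l\<close>, by
        \<open>(v - x, - z)\<close> and by the bounded preimage \<open>(a, b)\<close>, differ by a
        vector of both the image and \<open>F\<close>; directness makes their second components
        equal.\<close>
      have "f (v - x - a) = b + z" using ab(3) v(2) l(1) by (simp add: h_def f.diff f.add algebra_simps)
      moreover have "f (v - x - a) \<in> f ` M" using v l ab M by (intro imageI subspace_diff)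
      moreover have "b + z \<in> F" using ab l F by (intro subspace_add)
      ultimately have "b = - z" using direct by (auto simp: eq_neg_iff_add_eq_0)
      then show ?thesis using ab(4) norm_snd_le[of b a] by simp
    qed
    moreover have "(\<lambda>n. C * norm (y n - l)) \<longlonglongrightarrow> C * 0"
      using lim by (intro tendsto_mult tendsto_const) (simp add: LIM_zero_iff tendsto_norm_zero)
    ultimately have "norm z \<le> C * 0" by (intro LIMSEQ_le_const) auto
    then show "l \<in> f ` M" using l by auto
  qed
qed

section \<open>Finite-dimensional subspaces\<close>

lemma csubspace_imp_subspace: "csubspace V \<Longrightarrow> subspace V"
  unfolding complex_vector.subspace_def subspace_def by (simp flip: scaleC_of_real)

lemma bounded_linear_scaleC: "bounded_linear (\<lambda>x::'a::complex_banach. k *\<^sub>C x)"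
proof
  fix r and b :: 'a
  show "k *\<^sub>C r *\<^sub>R b = r *\<^sub>R k *\<^sub>C b"
    by (simp add: scaleC_scaleC mult.commute flip: scaleC_of_real)
qed (auto simp: scaleC_add_right norm_scaleC mult.commute intro!: exI[of _ "cmod k"])

text \<open>Unless \<open>b\<close> already lies in \<open>V\<close>, its distance from the closed
  \<open>V\<close> controls the coefficient of \<open>b\<close>, so along a convergent sequence the
  coefficients are Cauchy and converge too.\<close>

lemma closed_add_line:
  fixes V :: "'a::complex_banach set"
  assumes V: "csubspace V" "closed V"
  shows "closed {x. \<exists>k. x - k *\<^sub>C b \<in> V}"
proof (cases "b \<in> V")
  case True
  have "{x. \<exists>k. x - k *\<^sub>C b \<in> V} = V"
  proof safe
    fix x k assume "x - k *\<^sub>C b \<in> V"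
    then have "(x - k *\<^sub>C b) + k *\<^sub>C b \<in> V"
      using True V by (intro complex_vector.subspace_add complex_vector.subspace_scale)
    then show "x \<in> V" by simp
  next
    fix x assume "x \<in> V"
    then show "\<exists>k. x - k *\<^sub>C b \<in> V" by (intro exI[of _ 0]) simp
  qed
  then show ?thesis using V by simp
next
  case False
  then obtain d where d: "d > 0" "\<And>v. v \<in> V \<Longrightarrow> d \<le> norm (b - v)"
    using V(2) open_contains_ball[of "- V"]
    by (force simp: dist_norm open_Compl subset_iff not_less[symmetric])
  have bound: "cmod k * d \<le> norm (k *\<^sub>C b + v)" if "v \<in> V" for k v
  proof (cases "k = 0")
    case False
    have "- (inverse k *\<^sub>C v) \<in> V"
      using that V by (intro complex_vector.subspace_neg complex_vector.subspace_scale)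
    then have "d \<le> norm (b + inverse k *\<^sub>C v)" using d(2) by force
    then have "cmod k * d \<le> norm (k *\<^sub>C (b + inverse k *\<^sub>C v))"
      by (simp add: norm_scaleC mult_left_mono)
    also have "k *\<^sub>C (b + inverse k *\<^sub>C v) = k *\<^sub>C b + v"
      using False by (simp add: scaleC_add_right scaleC_scaleC scaleC_one)
    finally show ?thesis .
  qed simp
  show ?thesis
    unfolding closed_sequential_limits
  proof safe
    fix y l assume "\<forall>n. y n \<in> {x. \<exists>k. x - k *\<^sub>C b \<in> V}" and lim: "y \<longlonglongrightarrow> l"
    then obtain k where k: "\<And>n. y n - k n *\<^sub>C b \<in> V" by (auto simp: choice_iff)
    have kd: "cmod (k m - k n) * d \<le> norm (y m - y n)" for m n
    proof -
      have "(y m - k m *\<^sub>C b) - (y n - k n *\<^sub>C b) \<in> V"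
        by (rule complex_vector.subspace_diff[OF V(1) k k])
      from bound[OF this, of "k m - k n"] show ?thesis
        by (simp add: complex_vector.scale_left_diff_distrib)
    qed
    have "Cauchy k"
    proof (rule metric_CauchyI)
      fix e :: real assume "0 < e"
      then obtain N where "\<And>m n. m \<ge> N \<Longrightarrow> n \<ge> N \<Longrightarrow> norm (y m - y n) < e * d"
        using LIMSEQ_imp_Cauchy[OF lim] d(1) unfolding Cauchy_def dist_norm
        by (metis mult_pos_pos)
      then have "dist (k m) (k n) < e" if "m \<ge> N" "n \<ge> N" for m n
        using that kd[of m n] d(1) by (smt (verit) dist_norm mult_less_cancel_right_pos)
      then show "\<exists>M. \<forall>m\<ge>M. \<forall>n\<ge>M. dist (k m) (k n) < e" by blast
    qed
    then obtain c where c: "k \<longlonglongrightarrow> c" using Cauchy_convergent_iff convergent_def by blast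
    have "(\<lambda>n. k n *\<^sub>C b) \<longlonglongrightarrow> c *\<^sub>C b"
    proof (rule Lim_null[THEN iffD2], rule tendsto_norm_zero_cancel)
      have "(\<lambda>n. cmod (k n - c) * norm b) \<longlonglongrightarrow> 0 * norm b"
        by (intro tendsto_mult tendsto_const tendsto_norm_zero LIM_zero c)
      then show "(\<lambda>n. norm (k n *\<^sub>C b - c *\<^sub>C b)) \<longlonglongrightarrow> 0"
        by (simp add: norm_scaleC flip: complex_vector.scale_left_diff_distrib)
    qed
    then have "l - c *\<^sub>C b \<in> V"
      by (rule closed_sequentially[OF V(2) k tendsto_diff[OF lim]])
    then show "\<exists>k. l - k *\<^sub>C b \<in> V" by blast
  qed
qed

lemma closed_cspan_finite:
  "finite S \<Longrightarrow> closed (cspan (S :: 'a::complex_banach set))"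
  by (induction S rule: finite_induct)
    (simp_all add: complex_vector.span_insert closed_add_line complex_vector.subspace_span)

text \<open>Greedy choice: a generator already lying in the span of the chosen ones modulo
  \<open>V\<close> is dropped, any other is kept, which preserves trivial intersection with
  \<open>V\<close>.\<close>

lemma direct_complement_in_span:
  fixes V :: "'a::complex_banach set"
  assumes "finite S" and V: "csubspace V"
  obtains S' where "S' \<subseteq> S" "cspan S' \<inter> V \<subseteq> {0}" "\<And>x. x \<in> cspan S \<Longrightarrow> \<exists>y\<in>cspan S'. x - y \<in> V"
proof -
  have "\<exists>S'\<subseteq>S. cspan S' \<inter> V \<subseteq> {0} \<and> (\<forall>x\<in>cspan S. \<exists>y\<in>cspan S'. x - y \<in> V)"
    using assms(1)
  proof (induction S rule: finite_induct)
    case empty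
    then show ?case using complex_vector.subspace_0[OF V] by simp
  next
    case (insert b S)
    from insert.IH obtain S' where S': "S' \<subseteq> S" "cspan S' \<inter> V \<subseteq> {0}"
      "\<And>x. x \<in> cspan S \<Longrightarrow> \<exists>y\<in>cspan S'. x - y \<in> V" by auto
    show ?case
    proof (cases "\<exists>y\<in>cspan S'. b - y \<in> V")
      case True
      then obtain y where y: "y \<in> cspan S'" "b - y \<in> V" by blast
      have "\<exists>z\<in>cspan S'. x - z \<in> V" if x: "x \<in> cspan (insert b S)" for x
      proof -
        obtain k where "x - k *\<^sub>C b \<in> cspan S" using x by (auto simp: complex_vector.span_insert)
        then obtain w where w: "w \<in> cspan S'" "x - k *\<^sub>C b - w \<in> V" using S'(3) by blast
        have "w + k *\<^sub>C y \<in> cspan S'"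
          using w y by (intro complex_vector.span_add complex_vector.span_scale)
        moreover have "(x - k *\<^sub>C b - w) + k *\<^sub>C (b - y) \<in> V"
          using w y V by (intro complex_vector.subspace_add complex_vector.subspace_scale)
        then have "x - (w + k *\<^sub>C y) \<in> V"
          by (simp add: complex_vector.scale_right_diff_distrib algebra_simps)
        ultimately show ?thesis by blast
      qed
      then show ?thesis using S' by (intro exI[of _ S']) auto
    next
      case False
      have "z = 0" if z: "z \<in> cspan (insert b S')" "z \<in> V" for z
      proof -
        obtain k where k: "z - k *\<^sub>C b \<in> cspan S'" using z by (auto simp: complex_vector.span_insert)
        \<comment> \<open>A nonzero coefficient would allow solving for \<open>b\<close> modulo
          \<open>V\<close> within the span of \<open>S'\<close>, against the case
          assumption.\<close>
        have "k = 0"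
        proof (rule ccontr)
          assume "k \<noteq> 0"
          then have eq: "b - inverse k *\<^sub>C (- (z - k *\<^sub>C b)) = inverse k *\<^sub>C z"
            by (simp add: complex_vector.scale_right_diff_distrib scaleC_scaleC scaleC_one)
          have "inverse k *\<^sub>C (- (z - k *\<^sub>C b)) \<in> cspan S'"
            using k by (intro complex_vector.span_scale complex_vector.span_neg)
          moreover have "inverse k *\<^sub>C z \<in> V" using z V by (intro complex_vector.subspace_scale)
          ultimately show False using False eq by metis
        qed
        then show ?thesis using k z S'(2) by auto
      qed
      moreover have "\<exists>y\<in>cspan (insert b S'). x - y \<in> V" if x: "x \<in> cspan (insert b S)" for x
      proof -
        obtain k where "x - k *\<^sub>C b \<in> cspan S" using x by (auto simp: complex_vector.span_insert)
        then obtain w where w: "w \<in> cspan S'" "x - k *\<^sub>C b - w \<in> V" using S'(3) by blast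
        have "w + k *\<^sub>C b \<in> cspan (insert b S')"
          using w unfolding complex_vector.span_insert by (auto intro!: exI[of _ k])
        then show ?thesis using w by (auto simp: algebra_simps intro!: bexI[of _ "w + k *\<^sub>C b"])
      qed
      ultimately show ?thesis using S'(1) by (intro exI[of _ "insert b S'"]) auto
    qed
  qed
  then show thesis by (elim exE conjE) (rule that, auto)
qed

text \<open>A basis of \<open>U\<close> extends to one of \<open>W\<close>. The finite spanning set
  makes these bases finite, so that their cardinalities compare as dimensions should.\<close>

lemma dim_mono_in_finite_span:
  fixes U W :: "'a::complex_banach set"
  assumes U: "csubspace U" and UW: "U \<subseteq> W" and W: "W \<subseteq> cspan S" "finite S"
  shows "complex_vector.dim U \<le> complex_vector.dim W"
    and "complex_vector.dim U = complex_vector.dim W \<Longrightarrow> U = W"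
proof -
  obtain I where I: "I \<subseteq> U" "complex_vector.independent I" "U \<subseteq> cspan I"
    "card I = complex_vector.dim U"
    using complex_vector.basis_exists[of U] by blast
  obtain J where J: "I \<subseteq> J" "J \<subseteq> W" "complex_vector.independent J" "W \<subseteq> cspan J"
    using complex_vector.maximal_independent_subset_extend[of I W] I UW by blast
  have fin: "finite J" using complex_vector.independent_span_bound[OF W(2) J(3)] J(2) W(1) by blast
  have cJ: "card J = complex_vector.dim W" using J by (intro complex_vector.basis_card_eq_dim)
  show "complex_vector.dim U \<le> complex_vector.dim W"
    using card_mono[OF fin J(1)] I cJ by simp
  assume "complex_vector.dim U = complex_vector.dim W"
  then have "I = J" using fin J(1) I cJ by (intro card_subset_eq) auto
  then have "W \<subseteq> U" using J(4) complex_vector.span_minimal[OF I(1) U] by blast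
  then show "U = W" using UW by blast
qed

lemma decreasing_subspaces_stabilise:
  fixes V :: "nat \<Rightarrow> 'a::complex_banach set"
  assumes V: "\<And>j. csubspace (V j)" and dec: "\<And>i j. i \<le> j \<Longrightarrow> V j \<subseteq> V i"
    and fin: "finite_dim (V m)"
  obtains k where "m \<le> k" "\<And>j. k \<le> j \<Longrightarrow> V j = V k"
proof -
  obtain S where S: "finite S" "cspan S = V m" using fin by (auto simp: finite_dim_def)
  obtain k where k: "m \<le> k" "\<And>j. m \<le> j \<Longrightarrow> complex_vector.dim (V k) \<le> complex_vector.dim (V j)"
    using ex_has_least_nat[of "\<lambda>j. m \<le> j" m "\<lambda>j. complex_vector.dim (V j)"] by blast
  have "V j = V k" if "k \<le> j" for j
  proof (rule dim_mono_in_finite_span(2)[OF V dec[OF that] _ S(1)])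
    show Vk: "V k \<subseteq> cspan S" using dec k(1) S(2) by simp
    show "complex_vector.dim (V j) = complex_vector.dim (V k)"
      using dim_mono_in_finite_span(1)[OF V dec[OF that] Vk S(1)] k that by (simp add: order_antisym)
  qed
  then show thesis using k(1) that by blast
qed

section \<open>Ascent and descent of bounded operators\<close>

locale bounded_complex_operator =
  fixes B :: "'a::complex_banach \<Rightarrow> 'a"
  assumes bounded_linear: "bounded_linear B"
    and scaleC: "B (c *\<^sub>C x) = c *\<^sub>C B x"
begin

sublocale bounded_linear B by (rule bounded_linear)

section \<open>Linear images and iterated ranges\<close>

lemma csubspace_image:
  assumes "csubspace M"
  shows "csubspace (B ` M)"
  unfolding complex_vector.subspace_def
proof safe
  show "0 \<in> B ` M" using complex_vector.subspace_0[OF assms] zero by (metis imageI)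
next
  fix x y assume "x \<in> M" "y \<in> M"
  then show "B x + B y \<in> B ` M"
    unfolding add[symmetric] using complex_vector.subspace_add[OF assms] by blast
next
  fix c x assume "x \<in> M"
  then show "c *\<^sub>C B x \<in> B ` M"
    unfolding scaleC[symmetric] using complex_vector.subspace_scale[OF assms] by blast
qed

lemma csubspace_kernel: "csubspace {x. B x = 0}"
  unfolding complex_vector.subspace_def by (simp add: zero add scaleC)

lemma closed_kernel: "closed {x. B x = 0}"
  by (intro closed_Collect_eq continuous_on_const linear_continuous_on bounded_linear)

lemma image_cspan_subset: "x \<in> cspan S \<Longrightarrow> B x \<in> cspan (B ` S)"
proof (induction rule: complex_vector.span_induct)
  case base
  show ?case unfolding complex_vector.subspace_def
    by (auto simp: zero add scaleC complex_vector.span_zero complex_vector.span_add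
        complex_vector.span_scale)
qed (auto intro: complex_vector.span_base)

lemma power: "bounded_complex_operator (B ^^ n)"
proof (induction n)
  case (Suc n)
  interpret Bn: bounded_complex_operator "B ^^ n" by (rule Suc)
  show ?case
    using bounded_linear_compose[OF bounded_linear Bn.bounded_linear]
    by unfold_locales (simp_all add: o_def Bn.scaleC scaleC add Bn.add Bn.scaleR scaleR
        Bn.bounded_linear bounded_linear.bounded)
qed (unfold_locales, auto intro!: exI[of _ 1])

lemma csubspace_range_power: "csubspace (range (B ^^ n))"
  by (rule bounded_complex_operator.csubspace_image[OF power complex_vector.subspace_UNIV])

lemma range_power_Suc: "range (B ^^ Suc n) = B ` range (B ^^ n)"
  by (simp add: image_comp)

lemma range_power_antimono: "i \<le> j \<Longrightarrow> range (B ^^ j) \<subseteq> range (B ^^ i)"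
proof (induction rule: dec_induct)
  case (step j)
  have "range (B ^^ Suc j) \<subseteq> range (B ^^ j)" by (auto simp: funpow_swap1)
  then show ?case using step by blast
qed simp

text \<open>A range of finite codimension has a finite-dimensional, hence closed, algebraic complement.\<close>

lemma closed_image_finite_codim:
  assumes M: "csubspace M" "closed M" and inv: "B ` M \<subseteq> M" and fin: "finite_codim_in M (B ` M)"
  shows "closed (B ` M)"
proof -
  obtain S where S: "finite S" "S \<subseteq> M" "\<And>x. x \<in> M \<Longrightarrow> \<exists>y\<in>cspan S. x - y \<in> B ` M"
    using fin unfolding finite_codim_in_def by auto
  obtain S' where S': "S' \<subseteq> S" "cspan S' \<inter> B ` M \<subseteq> {0}"
    "\<And>x. x \<in> cspan S \<Longrightarrow> \<exists>y\<in>cspan S'. x - y \<in> B ` M"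
    using direct_complement_in_span[OF S(1) csubspace_image[OF M(1)]] by metis
  have S'M: "cspan S' \<subseteq> M" using S(2) S'(1) M(1) by (intro complex_vector.span_minimal) auto
  have "{y + z | y z. y \<in> B ` M \<and> z \<in> cspan S'} = M"
  proof
    show "{y + z | y z. y \<in> B ` M \<and> z \<in> cspan S'} \<subseteq> M"
      using inv S'M complex_vector.subspace_add[OF M(1)] by blast
    show "M \<subseteq> {y + z | y z. y \<in> B ` M \<and> z \<in> cspan S'}"
    proof
      fix x assume "x \<in> M"
      then obtain y z where "y \<in> cspan S" "x - y \<in> B ` M" "z \<in> cspan S'" "y - z \<in> B ` M"
        using S(3) S'(3) by meson
      then have "(x - y) + (y - z) \<in> B ` M" "z \<in> cspan S'"
        using complex_vector.subspace_add[OF csubspace_image[OF M(1)]] by blast+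
      then show "x \<in> {y + z | y z. y \<in> B ` M \<and> z \<in> cspan S'}"
        by (intro CollectI exI[of _ "x - z"] exI[of _ z]) simp
    qed
  qed
  then show ?thesis
    using S' finite_subset[OF S'(1) S(1)] M
    by (intro closed_image_if_closed_complement[OF bounded_linear, of M "cspan S'"])
      (auto simp: closed_cspan_finite csubspace_imp_subspace complex_vector.subspace_span)
qed

text \<open>Images under \<open>B\<close> of representatives of \<open>M\<close> modulo its image
  represent the image modulo the next one.\<close>

lemma finite_codim_image:
  assumes "finite_codim_in M (B ` M)"
  shows "finite_codim_in (B ` M) (B ` B ` M)"
proof -
  obtain S where S: "finite S" "S \<subseteq> M" "\<And>x. x \<in> M \<Longrightarrow> \<exists>y\<in>cspan S. x - y \<in> B ` M"
    using assms unfolding finite_codim_in_def by auto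
  have "\<exists>y\<in>cspan (B ` S). B x - y \<in> B ` B ` M" if x: "x \<in> M" for x
  proof -
    obtain y where y: "y \<in> cspan S" "x - y \<in> B ` M" using S(3)[OF x] by blast
    then have "B x - B y \<in> B ` B ` M" by (metis diff imageI)
    then show ?thesis using image_cspan_subset[OF y(1)] by blast
  qed
  then show ?thesis unfolding finite_codim_in_def
    using S by (intro exI[of _ "B ` S"]) auto
qed

text \<open>Closedness of the next range uses finite codimension in the current one, so the
  induction carries both properties.\<close>

lemma closed_range_power_finite_codim:
  assumes "closed (range (B ^^ n))" "finite_codim_in (range (B ^^ n)) (range (B ^^ Suc n))"
    and "n \<le> j"
  shows "closed (range (B ^^ j))"
proof -
  have "closed (range (B ^^ j)) \<and> finite_codim_in (range (B ^^ j)) (range (B ^^ Suc j))"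
    using assms(3)
  proof (induction rule: dec_induct)
    case (step j)
    then have *: "closed (range (B ^^ j))" "finite_codim_in (range (B ^^ j)) (B ` range (B ^^ j))"
      by (simp_all only: range_power_Suc)
    have "B ` range (B ^^ j) \<subseteq> range (B ^^ j)"
      using range_power_antimono[of j "Suc j"] by (simp only: range_power_Suc)
    then have "closed (B ` range (B ^^ j))"
      by (intro closed_image_finite_codim csubspace_range_power *)
    then show ?case using finite_codim_image[OF *(2)] by (simp only: range_power_Suc)
  qed (use assms in blast)
  then show ?thesis by blast
qed

text \<open>If \<open>x\<close> were a nonzero kernel vector of \<open>B\<close> in \<open>M\<close>, a backward orbit
  \<open>x = x\<^sub>0, x\<^sub>1, \<dots>\<close> with \<open>B x\<^sub>j\<^sub>+\<^sub>1 = x\<^sub>j\<close> and geometric growth would give the eigenvector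
  \<open>\<Sum> t\<^sup>j x\<^sub>j\<close> of every small eigenvalue \<open>t\<close>.\<close>

lemma kernel_trivial_on_core:
  assumes M: "csubspace M" "closed M" "B ` M = M"
    and "e > 0" and inj: "\<And>t x. 0 < t \<Longrightarrow> t < e \<Longrightarrow> B x = t *\<^sub>R x \<Longrightarrow> x = 0"
    and x: "x \<in> M" "B x = 0"
  shows "x = 0"
proof -
  obtain C where C: "C > 0" "\<And>y. y \<in> M \<Longrightarrow> \<exists>z\<in>M. B z = y \<and> norm z \<le> C * norm y"
    using open_mapping[OF bounded_linear csubspace_imp_subspace[OF M(1)] M(2)] M(2,3) by metis
  then obtain g where g: "\<And>y. y \<in> M \<Longrightarrow> g y \<in> M \<and> B (g y) = y \<and> norm (g y) \<le> C * norm y"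
    by metis
  \<comment> \<open>\<open>t < e\<close> makes the injectivity assumption apply;
    \<open>t * C \<le> 1 / 3\<close> beats the growth of the backward orbit and bounds the tail of
    the series by half of \<open>norm x\<close>.\<close>
  define t where "t = min (e / 2) (1 / (3 * C))"
  have t: "0 < t" "t < e" "t * C \<le> 1 / 3"
    using \<open>e > 0\<close> C(1) by (auto simp: t_def min_def field_simps)
  define w where "w j = t ^ j *\<^sub>R (g ^^ j) x" for j
  have gM: "(g ^^ j) x \<in> M" for j by (induction j) (use x g in auto)
  have nw: "norm (w j) \<le> (1/3)^j * norm x" for j
  proof (induction j)
    case (Suc j)
    have "norm (w (Suc j)) = t * (t^j * norm (g ((g ^^ j) x)))" using t by (simp add: w_def)
    also have "\<dots> \<le> t * (t^j * (C * norm ((g ^^ j) x)))"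
      using g[OF gM[of j]] t by (intro mult_left_mono) auto
    also have "\<dots> = (t * C) * norm (w j)" using t by (simp add: w_def)
    also have "\<dots> \<le> (1/3) * ((1/3)^j * norm x)"
      using t C Suc by (intro mult_mono) auto
    finally show ?case by simp
  qed (simp add: w_def)
  have geo: "(\<lambda>j. (1/3)^Suc j * norm x) sums (norm x / 2)"
    using sums_mult[OF geometric_sums[of "1/3::real"], of "norm x / 3"] by (simp add: mult.commute)
  have ns: "summable (\<lambda>j. norm (w (Suc j)))"
    by (rule summable_comparison_test'[OF sums_summable[OF geo], of 0]) (use nw[of "Suc _"] in simp)
  then have sS: "summable (\<lambda>j. w (Suc j))" by (rule summable_norm_cancel)
  then have s: "summable w" by (simp only: summable_Suc_iff)
  have Bw: "B (w (Suc j)) = t *\<^sub>R w j" for j using g[OF gM[of j]] by (simp add: w_def scaleR)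
  have split: "suminf w = x + (\<Sum>j. w (Suc j))"
    using suminf_split_head[OF s] by (simp add: w_def)
  have "B (suminf w) = B x + (\<Sum>j. B (w (Suc j)))"
    unfolding split by (simp add: add suminf[OF sS])
  also have "\<dots> = t *\<^sub>R suminf w" using x(2) by (simp add: Bw suminf_scaleR_right[OF s])
  finally have "suminf w = 0" using inj t by blast
  \<comment> \<open>With the sum zero, \<open>x\<close> is the negative of the tail, whose norm is
    at most \<open>norm x / 2\<close>.\<close>
  then have "norm x = norm (\<Sum>j. w (Suc j))" using split by (metis add_eq_0_iff norm_minus_cancel)
  also have "\<dots> \<le> (\<Sum>j. norm (w (Suc j)))" by (rule summable_norm[OF ns])
  also have "\<dots> \<le> (\<Sum>j. (1/3)^Suc j * norm x)" by (rule suminf_le[OF nw ns sums_summable[OF geo]])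
  also have "\<dots> = norm x / 2" using sums_unique[OF geo] by simp
  finally show "x = 0" by simp
qed

text \<open>Injectivity and the open mapping theorem bound \<open>B\<close> below on
  \<open>M\<close>. Solutions \<open>x\<close> of \<open>B x - t x = y\<close> thus stay bounded as
  \<open>t\<close> tends to 0, so \<open>B x\<close> tends to \<open>y\<close>, and the closed range
  contains \<open>y\<close>.\<close>

lemma surj_of_injective_closed_range:
  assumes M: "csubspace M" "closed M" "closed (B ` M)"
    and inj: "\<And>x. x \<in> M \<Longrightarrow> B x = 0 \<Longrightarrow> x = 0"
    and "e > 0" and surj: "\<And>t y. 0 < t \<Longrightarrow> t < e \<Longrightarrow> y \<in> M \<Longrightarrow> \<exists>x\<in>M. B x - t *\<^sub>R x = y"
  shows "M \<subseteq> B ` M"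
proof
  fix y assume y: "y \<in> M"
  obtain C where C: "C > 0" "\<And>y. y \<in> B ` M \<Longrightarrow> \<exists>z\<in>M. B z = y \<and> norm z \<le> C * norm y"
    using open_mapping[OF bounded_linear csubspace_imp_subspace[OF M(1)] M(2,3)] by metis
  have bound: "norm x \<le> C * norm (B x)" if x: "x \<in> M" for x
  proof -
    obtain z where z: "z \<in> M" "B z = B x" "norm z \<le> C * norm (B x)" using C(2)[of "B x"] x by blast
    have "z - x = 0"
      using z x complex_vector.subspace_diff[OF M(1)] by (intro inj[of "z - x"]) (simp_all add: diff)
    then show ?thesis using z by simp
  qed
  have "y \<in> closure (B ` M)" unfolding closure_approachable
  proof (intro allI impI)
    fix d :: real assume "d > 0"
    \<comment> \<open>The second entry lets the term with \<open>norm x\<close> be absorbed on the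
      left, the third makes the error \<open>t * norm x\<close> smaller than \<open>d\<close>;
      \<open>norm y + 1\<close> keeps the denominator positive when \<open>y = 0\<close>.\<close>
    define t where "t = Min {e / 2, 1 / (2 * C), d / (2 * C * (norm y + 1))}"
    have t: "0 < t" "t < e" "t * C \<le> 1 / 2" "t * (2 * C * (norm y + 1)) \<le> d"
    proof -
      have pos: "2 * C * (norm y + 1) > 0" using C by (simp add: add_nonneg_pos)
      show "0 < t" using \<open>e > 0\<close> \<open>d > 0\<close> C pos by (simp add: t_def)
      show "t < e" using \<open>e > 0\<close> by (simp add: t_def min_less_iff_disj)
      have "t \<le> 1 / (2 * C)" "t \<le> d / (2 * C * (norm y + 1))" by (auto simp: t_def)
      then show "t * C \<le> 1 / 2" "t * (2 * C * (norm y + 1)) \<le> d"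
        using C pos by (simp_all add: pos_le_divide_eq mult_ac)
    qed
    obtain x where x: "x \<in> M" "B x - t *\<^sub>R x = y" using surj t y by blast
    then have Bx: "B x = y + t *\<^sub>R x" by (simp add: algebra_simps)
    have "norm x \<le> C * norm (B x)" using bound x by blast
    also have "\<dots> \<le> C * (norm y + t * norm x)"
      using C t norm_triangle_ineq[of y "t *\<^sub>R x"] by (simp add: Bx)
    also have "\<dots> = C * norm y + (t * C) * norm x" by (simp add: algebra_simps)
    also have "\<dots> \<le> C * norm y + 1/2 * norm x" using t by (intro add_left_mono mult_right_mono) auto
    finally have nx: "norm x \<le> 2 * C * norm y" by simp
    have "dist (B x) y = t * norm x" using t by (simp add: Bx dist_norm)
    also have "\<dots> \<le> t * (2 * C * norm y)" using t nx by simp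
    also have "\<dots> < t * (2 * C * (norm y + 1))" using t C by simp
    also have "\<dots> \<le> d" by (rule t)
    finally show "\<exists>z\<in>B ` M. dist z y < d" using x by blast
  qed
  then show "y \<in> B ` M" using M(3) by (simp add: closure_closed)
qed

section \<open>\<open>B - t\<close> and the kernel of \<open>B\<close> along the iterated
  ranges\<close>

lemma power_resolvent_commute:
  "(B ^^ n) (B w - t *\<^sub>C w) = B ((B ^^ n) w) - t *\<^sub>C (B ^^ n) w"
proof -
  interpret Bn: bounded_complex_operator "B ^^ n" by (rule power)
  show ?thesis by (simp add: Bn.diff Bn.scaleC funpow_swap1)
qed

text \<open>\<open>B ^^ n\<close> commutes with \<open>B - t\<close>, so it carries a solution for
  \<open>z\<close> to a solution for the image of \<open>z\<close> inside the range.\<close>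

lemma surj_on_range_power:
  assumes "surj (\<lambda>x. B x - t *\<^sub>C x)" and "y \<in> range (B ^^ n)"
  shows "\<exists>x\<in>range (B ^^ n). B x - t *\<^sub>C x = y"
proof -
  obtain z where "y = (B ^^ n) z" using assms(2) by blast
  moreover obtain w where "z = B w - t *\<^sub>C w" using assms(1) by (auto simp: surj_def)
  ultimately show ?thesis using power_resolvent_commute[of n w t]
    by (intro bexI[of _ "(B ^^ n) w"]) auto
qed

lemma kernel_range_power_stabilises:
  assumes fin: "finite_dim ({x. B x = 0} \<inter> range (B ^^ n))"
  obtains k where "n \<le> k"
    and "\<And>j. k \<le> j \<Longrightarrow> {x. B x = 0} \<inter> range (B ^^ j) = {x. B x = 0} \<inter> range (B ^^ k)"
proof -
  define V where "V j = {x. B x = 0} \<inter> range (B ^^ j)" for j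
  have V: "csubspace (V j)" for j unfolding V_def
    by (intro complex_vector.subspace_inter csubspace_kernel csubspace_range_power)
  have dec: "V j \<subseteq> V i" if "i \<le> j" for i j
    unfolding V_def using range_power_antimono[OF that] by blast
  show thesis
    using decreasing_subspaces_stabilise[of V n] V dec fin that unfolding V_def[symmetric] by metis
qed

text \<open>Preimages of \<open>y\<close> taken from different ranges differ by kernel vectors. Once
  the kernels inside the ranges have stabilised, these differences lie in every later range, so one
  preimage belongs to all ranges.\<close>

lemma image_core_eq:
  assumes fin: "finite_dim ({x. B x = 0} \<inter> range (B ^^ n))"
  shows "B ` (\<Inter>j. range (B ^^ j)) = (\<Inter>j. range (B ^^ j))"
proof
  show "B ` (\<Inter>j. range (B ^^ j)) \<subseteq> (\<Inter>j. range (B ^^ j))"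
    by (auto simp: funpow_swap1 image_iff) (metis funpow_swap1 rangeE rangeI)
  define V where "V j = {x. B x = 0} \<inter> range (B ^^ j)" for j
  obtain k where k: "\<And>j. k \<le> j \<Longrightarrow> V j = V k"
    using kernel_range_power_stabilises[OF fin] unfolding V_def by metis
  show "(\<Inter>j. range (B ^^ j)) \<subseteq> B ` (\<Inter>j. range (B ^^ j))"
  proof
    fix y assume y: "y \<in> (\<Inter>j. range (B ^^ j))"
    have pre: "\<exists>x\<in>range (B ^^ j). B x = y" for j
    proof -
      have "y \<in> range (B ^^ Suc j)" using y by blast
      then show ?thesis unfolding range_power_Suc by blast
    qed
    obtain x where x: "x \<in> range (B ^^ k)" "B x = y" using pre by blast
    have "x \<in> range (B ^^ j)" for j
    proof -
      define m where "m = max j k"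
      obtain z where z: "z \<in> range (B ^^ m)" "B z = y" using pre by blast
      have "z \<in> range (B ^^ k)" using z range_power_antimono[of k m] by (auto simp: m_def)
      then have "z - x \<in> V k" unfolding V_def using z x
        by (auto simp: diff intro!: complex_vector.subspace_diff csubspace_range_power)
      then have "z - x \<in> range (B ^^ m)" using k[of m] unfolding m_def V_def by auto
      then have "z - (z - x) \<in> range (B ^^ m)"
        by (rule complex_vector.subspace_diff[OF csubspace_range_power z(1)])
      then have "x \<in> range (B ^^ m)" by simp
      then show ?thesis using range_power_antimono[of j m] by (auto simp: m_def)
    qed
    then show "y \<in> B ` (\<Inter>j. range (B ^^ j))" using x by blast
  qed
qed

section \<open>Stabilised kernels and ranges, and the two directions for \<open>B\<close>\<close>

lemma kernel_power_stable:
  assumes "{x. (B ^^ a) x = 0} = {x. (B ^^ Suc a) x = 0}" and "a \<le> j"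
  shows "{x. (B ^^ j) x = 0} = {x. (B ^^ a) x = 0}"
  using assms(2)
proof (induction rule: dec_induct)
  case (step j)
  have eq: "(B ^^ Suc j) x = (B ^^ j) (B x)" for x by (simp add: funpow_swap1)
  have "(B ^^ Suc j) x = 0 \<longleftrightarrow> (B ^^ Suc a) x = 0" for x
    using step.IH unfolding eq by (auto simp: funpow_swap1)
  then show ?case using assms(1) by simp
qed simp

lemma range_power_stable:
  assumes "range (B ^^ d) = range (B ^^ Suc d)" and "d \<le> j"
  shows "range (B ^^ j) = range (B ^^ d)"
  using assms(2)
proof (induction rule: dec_induct)
  case (step j)
  then show ?case using assms(1) unfolding range_power_Suc by simp
qed simp

text \<open>Past ascent and descent the range of \<open>B\<^sup>n\<close> is algebraically complemented by the closed
  kernel of \<open>B\<^sup>n\<close>.\<close>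

lemma closed_range_of_finite_ascent_descent:
  assumes a: "{x. (B ^^ a) x = 0} = {x. (B ^^ Suc a) x = 0}"
    and d: "range (B ^^ d) = range (B ^^ Suc d)"
  obtains n where "closed (range (B ^^ n))" "{x. B x = 0} \<inter> range (B ^^ n) = {0}"
    "range (B ^^ Suc n) = range (B ^^ n)"
proof -
  define n where "n = max a d"
  interpret Bn: bounded_complex_operator "B ^^ n" by (rule power)
  have ker: "(B ^^ j) x = 0 \<longleftrightarrow> (B ^^ n) x = 0" if "n \<le> j" for j x
    using kernel_power_stable[OF a, of j] kernel_power_stable[OF a, of n] that
    by (auto simp: n_def)
  have ran: "range (B ^^ j) = range (B ^^ n)" if "n \<le> j" for j
    using range_power_stable[OF d, of j] range_power_stable[OF d, of n] that
    by (auto simp: n_def)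
  have double: "(B ^^ n) ((B ^^ n) x) = (B ^^ (n + n)) x" for x by (simp add: funpow_add)
  have "range (B ^^ n) \<inter> {x. (B ^^ n) x = 0} \<subseteq> {0}"
  proof
    fix y assume "y \<in> range (B ^^ n) \<inter> {x. (B ^^ n) x = 0}"
    then obtain x where x: "y = (B ^^ n) x" "(B ^^ n) ((B ^^ n) x) = 0" by blast
    then show "y \<in> {0}" using ker[of "n + n" x] by (simp only: double) simp
  qed
  \<comment> \<open>As \<open>B ^^ n\<close> and \<open>B ^^ (n + n)\<close> have the same range,
    some \<open>(B ^^ n) w\<close> has the same image under \<open>B ^^ n\<close> as
    \<open>x\<close>; the difference is the kernel part.\<close>
  moreover have "{y + z | y z. y \<in> range (B ^^ n) \<and> z \<in> {x. (B ^^ n) x = 0}} = UNIV"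
  proof -
    have "\<exists>y z. x = y + z \<and> y \<in> range (B ^^ n) \<and> (B ^^ n) z = 0" for x
    proof -
      have "(B ^^ n) x \<in> range (B ^^ (n + n))" using ran[of "n + n"] by simp
      then obtain w where "(B ^^ n) x = (B ^^ n) ((B ^^ n) w)" by (auto simp: double)
      then show ?thesis
        by (intro exI[of _ "(B ^^ n) w"] exI[of _ "x - (B ^^ n) w"]) (simp add: Bn.diff)
    qed
    then show ?thesis by blast
  qed
  ultimately have "closed (range (B ^^ n))"
    by (intro closed_image_if_closed_complement[OF Bn.bounded_linear, of UNIV "{x. (B ^^ n) x = 0}"])
      (simp_all add: Bn.closed_kernel csubspace_imp_subspace Bn.csubspace_kernel)
  moreover have "{x. B x = 0} \<inter> range (B ^^ n) = {0}"
  proof (intro equalityI subsetI)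
    fix y assume "y \<in> {x. B x = 0} \<inter> range (B ^^ n)"
    then show "y \<in> {0}" using ker[of "Suc n"] by auto
  next
    fix y :: 'a assume "y \<in> {0}"
    then show "y \<in> {x. B x = 0} \<inter> range (B ^^ n)"
      using zero rangeI[of "B ^^ n" 0] by (simp add: Bn.zero)
  qed
  ultimately show thesis using ran[of "Suc n"] that by simp
qed

lemma finite_ascent_descent_of_fredholm_range:
  assumes cl: "closed (range (B ^^ n))"
    and fin: "finite_dim ({x. B x = 0} \<inter> range (B ^^ n))"
    and cofin: "finite_codim_in (range (B ^^ n)) (range (B ^^ Suc n))"
    and e: "e > 0" and bij: "\<And>t. t \<noteq> 0 \<Longrightarrow> cmod t < e \<Longrightarrow> bij (\<lambda>x. B x - t *\<^sub>C x)"
  obtains k where "{x. (B ^^ k) x = 0} = {x. (B ^^ Suc k) x = 0}"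
    and "range (B ^^ k) = range (B ^^ Suc k)"
proof -
  have bijR: "bij (\<lambda>x. B x - t *\<^sub>R x)" if "0 < t" "t < e" for t
    using bij[of "complex_of_real t"] that by (simp add: scaleC_of_real)
  define R where "R = (\<Inter>j. range (B ^^ j))"
  have clj: "closed (range (B ^^ j))" if "n \<le> j" for j
    by (rule closed_range_power_finite_codim[OF cl cofin that])
  \<comment> \<open>The ranges decrease, so dropping the first \<open>n\<close> of them leaves the
    intersection unchanged and only closed sets remain.\<close>
  have "R = (\<Inter>j\<in>{n..}. range (B ^^ j))"
  proof (intro equalityI subsetI)
    fix x assume x: "x \<in> (\<Inter>j\<in>{n..}. range (B ^^ j))"
    have "x \<in> range (B ^^ j)" for j
      using x range_power_antimono[of j "max j n"] by auto
    then show "x \<in> R" by (simp add: R_def)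
  qed (simp add: R_def)
  then have clR: "closed R" using clj by (simp add: closed_INT)
  have subR: "csubspace R"
    unfolding R_def by (intro complex_vector.subspace_Int csubspace_range_power)
  have core: "x = 0" if "x \<in> R" "B x = 0" for x
  proof (rule kernel_trivial_on_core[OF subR clR _ e _ that])
    show "B ` R = R" unfolding R_def by (rule image_core_eq[OF fin])
    fix t x assume t: "0 < t" "t < e" and x: "B x = t *\<^sub>R x"
    have "B x - t *\<^sub>R x = B 0 - t *\<^sub>R 0" using x by (simp add: zero)
    then show "x = 0" using bijR[OF t] unfolding bij_def inj_def by blast
  qed
  define V where "V j = {x. B x = 0} \<inter> range (B ^^ j)" for j
  have dec: "V j \<subseteq> V i" if "i \<le> j" for i j
    unfolding V_def using range_power_antimono[OF that] by blast
  obtain k where k: "n \<le> k" "\<And>j. k \<le> j \<Longrightarrow> V j = V k"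
    using kernel_range_power_stabilises[OF fin] unfolding V_def by metis
  \<comment> \<open>By stabilisation, a kernel vector in the \<open>k\<close>-th range lies in every
    range, hence in \<open>R\<close>, where \<open>core\<close> applies.\<close>
  have inj: "x = 0" if "x \<in> range (B ^^ k)" "B x = 0" for x
  proof (rule core[OF _ that(2)])
    have "x \<in> V k" using that by (simp add: V_def)
    then have "x \<in> V (max j k)" for j using k(2)[of "max j k"] by simp
    then have "x \<in> V j" for j using dec[of j "max j k"] by auto
    then show "x \<in> R" by (auto simp: V_def R_def)
  qed
  have "range (B ^^ k) \<subseteq> B ` range (B ^^ k)"
  proof (rule surj_of_injective_closed_range[OF csubspace_range_power clj _ inj e])
    show "closed (B ` range (B ^^ k))" using clj[of "Suc k"] k(1) by (simp only: range_power_Suc)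
    show "\<exists>x\<in>range (B ^^ k). B x - t *\<^sub>R x = y"
      if "0 < t" "t < e" "y \<in> range (B ^^ k)" for t y
      using surj_on_range_power[of "complex_of_real t" y k] bijR[OF that(1,2)] that(3)
      by (simp add: scaleC_of_real bij_is_surj)
  qed (use k(1) in auto)
  then have "range (B ^^ k) = range (B ^^ Suc k)"
    using range_power_antimono[OF le_SucI[OF order_refl], of k]
    unfolding range_power_Suc by (rule equalityI)
  moreover have "{x. (B ^^ k) x = 0} = {x. (B ^^ Suc k) x = 0}"
  proof (intro equalityI subsetI)
    fix x assume "x \<in> {x. (B ^^ Suc k) x = 0}"
    then show "x \<in> {x. (B ^^ k) x = 0}" using inj[of "(B ^^ k) x"] by simp
  qed (simp add: zero)
  ultimately show thesis using that by blast
qed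

end

section \<open>Reduction to a bounded operator\<close>

locale operator_with_resolvent_point =
  fixes D :: "'a::complex_banach set" and S :: "'a \<Rightarrow> 'a" and c :: complex
  assumes linear_operator: "linear_operator_on UNIV D S"
    and resolvent_point: "c \<in> resolvent_set D S"
begin

definition resolvent :: "'a \<Rightarrow> 'a" where
  "resolvent = inv_into D (\<lambda>x. S x - c *\<^sub>C x)"

text \<open>The operator \<open>B\<close> of the overview. It is total because
  \<open>resolvent\<close> maps into \<open>D\<close>, so its powers need no domains; boundedness
  comes from the form in \<open>transform_eq\<close>.\<close>

definition transform :: "'a \<Rightarrow> 'a" where
  "transform y = S (resolvent y)"

lemma bij_shift: "bij_betw (\<lambda>x. S x - c *\<^sub>C x) D UNIV"
  using resolvent_point by (simp add: resolvent_set_def)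

lemma csubspace_domain: "csubspace D"
  using linear_operator by (simp add: linear_operator_on_def)

lemma S_add: "x \<in> D \<Longrightarrow> y \<in> D \<Longrightarrow> S (x + y) = S x + S y"
  and S_scaleC: "x \<in> D \<Longrightarrow> S (k *\<^sub>C x) = k *\<^sub>C S x"
  using linear_operator by (auto simp: linear_operator_on_def)

lemma resolvent_in_domain: "resolvent y \<in> D"
  using bij_betw_inv_into[OF bij_shift] by (auto simp: resolvent_def bij_betw_def)

lemma shift_resolvent: "S (resolvent y) - c *\<^sub>C resolvent y = y"
  using bij_betw_inv_into_right[OF bij_shift, of y] by (simp add: resolvent_def)

lemma resolvent_shift: "x \<in> D \<Longrightarrow> resolvent (S x - c *\<^sub>C x) = x"
  using bij_betw_inv_into_left[OF bij_shift, of x] by (simp add: resolvent_def)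

lemma bij_resolvent: "bij_betw resolvent UNIV D"
  unfolding resolvent_def by (rule bij_betw_inv_into[OF bij_shift])

lemma transform_eq: "transform y = y + c *\<^sub>C resolvent y"
  using shift_resolvent[of y] by (simp add: transform_def algebra_simps)

lemma resolvent_add: "resolvent (x + y) = resolvent x + resolvent y"
proof -
  have D: "resolvent x + resolvent y \<in> D"
    by (intro complex_vector.subspace_add csubspace_domain resolvent_in_domain)
  have "S (resolvent x + resolvent y) - c *\<^sub>C (resolvent x + resolvent y) = x + y"
    using shift_resolvent[of x] shift_resolvent[of y]
    by (simp add: S_add resolvent_in_domain scaleC_add_right algebra_simps)
  with resolvent_shift[OF D] show ?thesis by simp
qed

lemma resolvent_scaleC: "resolvent (k *\<^sub>C x) = k *\<^sub>C resolvent x"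
proof -
  have D: "k *\<^sub>C resolvent x \<in> D"
    by (intro complex_vector.subspace_scale csubspace_domain resolvent_in_domain)
  have "S (k *\<^sub>C resolvent x) - c *\<^sub>C k *\<^sub>C resolvent x = k *\<^sub>C (S (resolvent x) - c *\<^sub>C resolvent x)"
    by (simp add: S_scaleC resolvent_in_domain scaleC_scaleC mult.commute
        complex_vector.scale_right_diff_distrib)
  also have "\<dots> = k *\<^sub>C x" by (simp only: shift_resolvent)
  finally show ?thesis using resolvent_shift[OF D] by simp
qed

lemma bounded_linear_resolvent: "bounded_linear resolvent"
proof -
  obtain C where C: "\<And>x. x \<in> D \<Longrightarrow> norm x \<le> C * norm (S x - c *\<^sub>C x)"
    using resolvent_point by (auto simp: resolvent_set_def)
  show ?thesis
  proof
    show "resolvent (r *\<^sub>R b) = r *\<^sub>R resolvent b" for r b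
      using resolvent_scaleC[of "complex_of_real r" b] by (simp add: scaleC_of_real)
    show "\<exists>K. \<forall>x. norm (resolvent x) \<le> norm x * K"
      using C[OF resolvent_in_domain] by (auto simp: shift_resolvent mult.commute intro!: exI[of _ C])
  qed (rule resolvent_add)
qed

sublocale transform: bounded_complex_operator transform
proof (rule bounded_complex_operator.intro)
  have "bounded_linear (\<lambda>y. y + c *\<^sub>C resolvent y)"
    by (intro bounded_linear_add bounded_linear_ident
        bounded_linear_compose[OF bounded_linear_scaleC bounded_linear_resolvent])
  then show "bounded_linear transform" unfolding transform_eq[abs_def] .
  show "transform (k *\<^sub>C x) = k *\<^sub>C transform x" for k x
    by (simp add: transform_eq scaleC_add_right resolvent_scaleC scaleC_scaleC mult.commute)
qed

section \<open>Transfer of iterated ranges and nullspaces from \<open>S\<close> to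
  \<open>transform\<close>\<close>

lemma resolvent_S: "x \<in> D \<Longrightarrow> resolvent (S x) = transform x"
  using resolvent_shift[of x] resolvent_add[of "S x - c *\<^sub>C x" "c *\<^sub>C x"]
  by (simp add: transform_eq resolvent_scaleC)

lemma resolvent_transform: "resolvent (transform x) = transform (resolvent x)"
  by (simp add: transform_eq resolvent_add resolvent_scaleC)

lemma resolvent_transform_power: "resolvent ((transform ^^ n) x) = (transform ^^ n) (resolvent x)"
  by (induction n) (simp_all add: resolvent_transform)

lemma resolvent_eq_0_iff: "resolvent x = 0 \<longleftrightarrow> x = 0"
proof -
  have "resolvent 0 = 0" using resolvent_scaleC[of 0 0] by simp
  then show ?thesis using bij_resolvent unfolding bij_betw_def inj_on_def by (metis UNIV_I)
qed

text \<open>\<open>transform x\<close> and \<open>x\<close> differ by a multiple of a resolvent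
  value, which lies in \<open>D\<close>. Hence powers of \<open>transform\<close> neither enter nor
  leave the domain, which keeps the natural domains of the powers of \<open>S\<close>
  manageable.\<close>

lemma transform_in_domain_iff: "transform x \<in> D \<longleftrightarrow> x \<in> D"
proof
  assume "transform x \<in> D"
  then have "transform x - c *\<^sub>C resolvent x \<in> D"
    by (intro complex_vector.subspace_diff complex_vector.subspace_scale csubspace_domain
        resolvent_in_domain)
  then show "x \<in> D" by (simp add: transform_eq)
next
  assume "x \<in> D"
  then show "transform x \<in> D" unfolding transform_eq
    by (intro complex_vector.subspace_add complex_vector.subspace_scale csubspace_domain
        resolvent_in_domain)
qed

lemma transform_power_in_domain_iff: "(transform ^^ n) x \<in> D \<longleftrightarrow> x \<in> D"
  by (induction n) (simp_all add: transform_in_domain_iff)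

text \<open>Vectors of \<open>D\<close> in the range of \<open>transform ^^ n\<close> have the form
  \<open>resolvent ((transform ^^ n) w)\<close>, and \<open>S\<close> after \<open>resolvent\<close>
  is one more application of \<open>transform\<close>.\<close>

lemma image_range_power: "S ` (D \<inter> range (transform ^^ n)) = range (transform ^^ Suc n)"
proof (intro equalityI subsetI)
  fix y assume "y \<in> S ` (D \<inter> range (transform ^^ n))"
  then obtain z where z: "(transform ^^ n) z \<in> D" "y = S ((transform ^^ n) z)" by blast
  then have "z \<in> D" by (simp add: transform_power_in_domain_iff)
  then obtain w where "z = resolvent w" using resolvent_shift by metis
  then have "y = transform ((transform ^^ n) w)"
    by (simp add: z resolvent_transform_power[symmetric] transform_def)
  then show "y \<in> range (transform ^^ Suc n)" by (auto intro!: image_eqI[of _ _ w])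
next
  fix y assume "y \<in> range (transform ^^ Suc n)"
  then obtain w where "y = transform ((transform ^^ n) w)" by auto
  then have "y = S ((transform ^^ n) (resolvent w))"
    unfolding transform_def[of "(transform ^^ n) w"] by (simp add: resolvent_transform_power)
  moreover have "(transform ^^ n) (resolvent w) \<in> D"
    by (simp add: transform_power_in_domain_iff resolvent_in_domain)
  ultimately show "y \<in> S ` (D \<inter> range (transform ^^ n))" by blast
qed

text \<open>Peeling off the last iterate suits ranges; \<open>power_domain_Suc'\<close> peels off
  the first, which suits nullspaces.\<close>

lemma power_domain_Suc: "power_domain D S (Suc n) = {x \<in> power_domain D S n. (S ^^ n) x \<in> D}"
  by (auto simp: power_domain_def less_Suc_eq)

lemma power_domain_Suc': "power_domain D S (Suc n) = {x \<in> D. S x \<in> power_domain D S n}"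
  by (auto simp: power_domain_def less_Suc_eq_0_disj funpow_swap1)

lemma power_range_eq: "power_range D S n = range (transform ^^ n)"
proof (induction n)
  case 0
  show ?case by (simp add: power_range_def power_domain_def)
next
  case (Suc n)
  have "power_range D S (Suc n) = S ` (D \<inter> power_range D S n)"
    unfolding power_range_def power_domain_Suc by auto
  then show ?case unfolding Suc image_range_power .
qed

lemma power_nullspace_eq: "power_nullspace D S n = {x. (transform ^^ n) x = 0}"
proof (induction n)
  case 0
  show ?case by (auto simp: power_nullspace_def nullspace_def power_domain_def)
next
  case (Suc n)
  have "power_nullspace D S (Suc n) = {x \<in> D. S x \<in> power_nullspace D S n}"
    unfolding power_nullspace_def nullspace_def power_domain_Suc' by (auto simp: funpow_swap1)
  also have "\<dots> = {x \<in> D. (transform ^^ n) (S x) = 0}" unfolding Suc by simp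
  also have "\<dots> = {x \<in> D. (transform ^^ Suc n) x = 0}"
  proof -
    have "(transform ^^ n) (S x) = 0 \<longleftrightarrow> (transform ^^ Suc n) x = 0" if "x \<in> D" for x
    proof -
      \<comment> \<open>The resolvent is injective and commutes with \<open>transform\<close>, so
        inserting it keeps the kernel; it turns \<open>S x\<close> into
        \<open>transform x\<close>.\<close>
      have "(transform ^^ n) (S x) = 0 \<longleftrightarrow> (transform ^^ n) (resolvent (S x)) = 0"
        by (simp add: resolvent_eq_0_iff flip: resolvent_transform_power)
      also have "(transform ^^ n) (resolvent (S x)) = (transform ^^ Suc n) x"
        by (simp add: resolvent_S[OF that] funpow_swap1)
      finally show ?thesis .
    qed
    then show ?thesis by blast
  qed
  also have "\<dots> = {x. (transform ^^ Suc n) x = 0}"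
  proof -
    have "x \<in> D" if "(transform ^^ Suc n) x = 0" for x
      using that transform_power_in_domain_iff[of "Suc n" x] complex_vector.subspace_0[OF csubspace_domain]
      by metis
    then show ?thesis by blast
  qed
  finally show ?case .
qed

lemma nullspace_restriction_eq:
  "nullspace (D \<inter> range (transform ^^ n)) S = {x. transform x = 0} \<inter> range (transform ^^ n)"
proof -
  have "nullspace D S = {x. transform x = 0}"
    using power_nullspace_eq[of 1] by (simp add: power_nullspace_def power_domain_def)
  then show ?thesis by (auto simp: nullspace_def)
qed

text \<open>\<open>transform - t = (1 - t) (S - \<kappa>) resolvent\<close> for \<open>\<kappa> = - t c / (1 - t)\<close>.\<close>

lemma bij_transform_minus:
  assumes "t \<noteq> 1" and "- (t * c) / (1 - t) \<in> resolvent_set D S"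
  shows "bij (\<lambda>x. transform x - t *\<^sub>C x)"
proof -
  define \<kappa> where "\<kappa> = - (t * c) / (1 - t)"
  have \<kappa>: "(1 - t) * \<kappa> = - (t * c)" using assms(1) by (simp add: \<kappa>_def)
  have "bij_betw (\<lambda>x. S x - \<kappa> *\<^sub>C x) D UNIV"
    using assms(2) by (simp add: resolvent_set_def \<kappa>_def)
  then have "bij ((\<lambda>x. S x - \<kappa> *\<^sub>C x) \<circ> resolvent)"
    by (rule bij_betw_trans[OF bij_resolvent])
  moreover have "bij (\<lambda>x::'a. (1 - t) *\<^sub>C x)"
    using assms(1)
    by (intro bij_betw_byWitness[where f' = "\<lambda>x. inverse (1 - t) *\<^sub>C x"])
      (auto simp: scaleC_scaleC scaleC_one)
  ultimately have "bij ((\<lambda>x. (1 - t) *\<^sub>C x) \<circ> ((\<lambda>x. S x - \<kappa> *\<^sub>C x) \<circ> resolvent))"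
    by (rule bij_betw_trans)
  moreover have "(1 - t) *\<^sub>C (S (resolvent x) - \<kappa> *\<^sub>C resolvent x) = transform x - t *\<^sub>C x" for x
  proof -
    have "(1 - t) *\<^sub>C (S (resolvent x) - \<kappa> *\<^sub>C resolvent x)
        = transform x - t *\<^sub>C (x + c *\<^sub>C resolvent x) + (t * c) *\<^sub>C resolvent x"
      by (simp add: complex_vector.scale_right_diff_distrib scaleC_scaleC \<kappa>
          complex_vector.scale_left_diff_distrib flip: transform_def transform_eq)
    also have "\<dots> = transform x - t *\<^sub>C x" by (simp add: scaleC_add_right scaleC_scaleC)
    finally show ?thesis .
  qed
  ultimately show ?thesis by (simp add: o_def)
qed

text \<open>\<open>S\<close> maps the part of \<open>D\<close> in the range back into the range, so
  the graph of the restriction is the graph of \<open>S\<close> cut down to the product, hence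
  relatively closed there.\<close>

lemma closed_operator_restriction:
  assumes "closed_operator D S"
  shows "closed_operator_on (range (transform ^^ n)) (D \<inter> range (transform ^^ n)) S"
proof -
  let ?R = "range (transform ^^ n)"
  have sub: "S ` (D \<inter> ?R) \<subseteq> ?R"
    unfolding image_range_power by (rule transform.range_power_antimono) simp
  have "(\<lambda>x. (x, S x)) ` (D \<inter> ?R) = ?R \<times> ?R \<inter> (\<lambda>x. (x, S x)) ` D"
    using sub by (auto simp: image_subset_iff)
  moreover have "closed ((\<lambda>x. (x, S x)) ` D)"
    using assms by (simp add: closed_operator_on_def)
  ultimately have "closedin (top_of_set (?R \<times> ?R)) ((\<lambda>x. (x, S x)) ` (D \<inter> ?R))"
    by (auto simp: closedin_closed)
  moreover have "linear_operator_on ?R (D \<inter> ?R) S"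
    unfolding linear_operator_on_def
    using sub transform.csubspace_range_power[of n] csubspace_domain
    by (auto simp: S_add S_scaleC complex_vector.subspace_inter)
  ultimately show ?thesis by (simp add: closed_operator_on_def)
qed

lemma b_fredholm_iff:
  assumes "closed_operator D S"
  shows "b_fredholm D S \<longleftrightarrow>
    (\<exists>n. closed (range (transform ^^ n)) \<and>
      finite_dim ({x. transform x = 0} \<inter> range (transform ^^ n)) \<and>
      finite_codim_in (range (transform ^^ n)) (range (transform ^^ Suc n)))"
  using assms closed_operator_restriction[OF assms]
  by (simp only: b_fredholm_def fredholm_on_def power_range_eq nullspace_restriction_eq
      image_range_power simp_thms)

lemma drazin_invertible_iff:
  "drazin_invertible D S \<longleftrightarrow>
    (\<exists>a. {x. (transform ^^ a) x = 0} = {x. (transform ^^ Suc a) x = 0}) \<and>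
    (\<exists>d. range (transform ^^ d) = range (transform ^^ Suc d))"
proof -
  \<comment> \<open>The infimum of the empty set is infinity, so a finite ascent or descent means
    that some index exists.\<close>
  have "Inf {enat n | n. P n} \<noteq> \<infinity> \<longleftrightarrow> (\<exists>n. P n)" for P
  proof
    assume "Inf {enat n | n. P n} \<noteq> \<infinity>"
    then have "{enat n | n. P n} \<noteq> {}" by (rule contrapos_nn) (simp only: Inf_empty top_enat_def)
    then show "\<exists>n. P n" by blast
  next
    assume "\<exists>n. P n"
    then obtain n where "Inf {enat n | n. P n} \<le> enat n" by (auto intro: Inf_lower)
    then show "Inf {enat n | n. P n} \<noteq> \<infinity>" by (cases "Inf {enat n | n. P n}") auto
  qed
  then show ?thesis
    unfolding drazin_invertible_def ascent_def descent_def power_range_eq power_nullspace_eq by simp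
qed

lemma drazin_invertible_iff_b_fredholm:
  assumes "closed_operator D S" and "c \<noteq> 0" and "e > 0"
    and punctured: "\<And>\<kappa>. \<kappa> \<noteq> 0 \<Longrightarrow> cmod \<kappa> < e \<Longrightarrow> \<kappa> \<in> resolvent_set D S"
  shows "drazin_invertible D S \<longleftrightarrow> b_fredholm D S"
proof
  assume "drazin_invertible D S"
  then obtain n where n: "closed (range (transform ^^ n))"
    "{x. transform x = 0} \<inter> range (transform ^^ n) = {0}"
    "range (transform ^^ Suc n) = range (transform ^^ n)"
    unfolding drazin_invertible_iff
    by (elim conjE exE) (rule transform.closed_range_of_finite_ascent_descent)
  have "finite_dim {0::'a}" unfolding finite_dim_def by (intro exI[of _ "{}"]) simp
  moreover have "finite_codim_in (range (transform ^^ n)) (range (transform ^^ n))"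
    unfolding finite_codim_in_def by (intro exI[of _ "{}"]) auto
  ultimately show "b_fredholm D S"
    unfolding b_fredholm_iff[OF assms(1)] using n by (intro exI[of _ n]) (simp only: simp_thms)
next
  assume "b_fredholm D S"
  then obtain n where n: "closed (range (transform ^^ n))"
    "finite_dim ({x. transform x = 0} \<inter> range (transform ^^ n))"
    "finite_codim_in (range (transform ^^ n)) (range (transform ^^ Suc n))"
    unfolding b_fredholm_iff[OF assms(1)] by blast
  \<comment> \<open>The bound \<open>1 / 2\<close> gives \<open>cmod (1 - t) > 1 / 2\<close>, the
    other gives \<open>cmod (t * c) < e / 2\<close>; together they put the parameter of
    \<open>bij_transform_minus\<close> into the punctured disc.\<close>
  define d where "d = min (1 / 2) (e / (2 * cmod c))"
  have d: "d > 0" using assms by (simp add: d_def)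
  have "bij (\<lambda>x. transform x - t *\<^sub>C x)" if t: "t \<noteq> 0" "cmod t < d" for t
  proof (rule bij_transform_minus)
    have t1: "cmod (1 - t) > 1 / 2"
      using norm_triangle_ineq2[of 1 t] t by (simp add: d_def)
    then have pos: "cmod (1 - t) > 0" by linarith
    then show "t \<noteq> 1" by auto
    show "- (t * c) / (1 - t) \<in> resolvent_set D S"
    proof (rule punctured)
      show "- (t * c) / (1 - t) \<noteq> 0" using t \<open>t \<noteq> 1\<close> assms(2) by simp
      have "cmod t * cmod c < e / 2" using t assms(2) by (simp add: d_def field_simps)
      also have "\<dots> < e * cmod (1 - t)" using t1 assms(3) by (simp add: field_simps)
      finally show "cmod (- (t * c) / (1 - t)) < e"
        using t1 by (simp add: norm_divide norm_mult pos_divide_less_eq[OF pos])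
    qed
  qed
  then obtain k where "{x. (transform ^^ k) x = 0} = {x. (transform ^^ Suc k) x = 0}"
    "range (transform ^^ k) = range (transform ^^ Suc k)"
    using transform.finite_ascent_descent_of_fredholm_range[OF n d] by blast
  then show "drazin_invertible D S" unfolding drazin_invertible_iff by blast
qed

end

section \<open>From the shifted operator back to \<open>T\<close>\<close>

lemma resolvent_set_shift:
  "resolvent_set D (\<lambda>x. T x - \<mu> *\<^sub>C x) = {\<kappa>. \<kappa> + \<mu> \<in> resolvent_set D T}"
proof -
  have shift: "T x - \<mu> *\<^sub>C x - \<kappa> *\<^sub>C x = T x - (\<kappa> + \<mu>) *\<^sub>C x" for x \<kappa>
    by (simp add: scaleC_add_left algebra_simps)
  show ?thesis unfolding resolvent_set_def shift by simp
qed

text \<open>The new graph is the preimage of the graph of \<open>T\<close> under the continuous map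
  sending \<open>(x, y)\<close> to \<open>(x, y + \<mu> x)\<close>.\<close>

lemma closed_operator_shift:
  assumes "closed_operator D T"
  shows "closed_operator D (\<lambda>x. T x - \<mu> *\<^sub>C x)"
proof -
  have lin: "linear_operator_on UNIV D T" and cl: "closed ((\<lambda>x. (x, T x)) ` D)"
    using assms by (simp_all add: closed_operator_on_def)
  have "linear_operator_on UNIV D (\<lambda>x. T x - \<mu> *\<^sub>C x)"
    using lin by (auto simp: linear_operator_on_def scaleC_add_right scaleC_scaleC mult.commute
        complex_vector.scale_right_diff_distrib)
  moreover have "(\<lambda>x. (x, T x - \<mu> *\<^sub>C x)) ` D
      = (\<lambda>p. (fst p, snd p + \<mu> *\<^sub>C fst p)) -` (\<lambda>x. (x, T x)) ` D"
    by (auto simp: image_iff eq_diff_eq)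
  moreover have "closed ((\<lambda>p. (fst p, snd p + \<mu> *\<^sub>C fst p)) -` (\<lambda>x. (x, T x)) ` D)"
  proof (rule closed_vimage[OF cl])
    show "continuous_on UNIV (\<lambda>p. (fst p, snd p + \<mu> *\<^sub>C fst p))"
      by (intro continuous_intros bounded_linear.continuous_on[OF bounded_linear_scaleC])
  qed
  ultimately show ?thesis by (simp add: closed_operator_on_def)
qed

theorem theorem2p7:
  fixes D :: "'a :: complex_banach set" and T :: "'a \<Rightarrow> 'a" and \<mu> :: complex
  assumes "closed_operator D T"
    and "resolvent_set D T \<noteq> {}"
    and "\<mu> isolated_in spectrum D T"
  shows "\<mu> \<in> b_discrete_spectrum D T \<longleftrightarrow> b_fredholm D (\<lambda>x. T x - \<mu> *\<^sub>C x)"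
proof -
  let ?S = "\<lambda>x. T x - \<mu> *\<^sub>C x"
  obtain \<nu> where \<nu>: "\<nu> \<in> resolvent_set D T" using assms(2) by blast
  have \<mu>: "\<mu> \<in> spectrum D T" using assms(3) by (simp add: isolated_in_def)
  obtain e where e: "e > 0" "\<And>\<kappa>. \<kappa> \<in> spectrum D T \<Longrightarrow> dist \<mu> \<kappa> < e \<Longrightarrow> \<kappa> = \<mu>"
    using assms(3) unfolding isolated_in_dist_Ex_iff by meson
  have closed_S: "closed_operator D ?S" by (rule closed_operator_shift[OF assms(1)])
  interpret operator_with_resolvent_point D ?S "\<nu> - \<mu>"
    using closed_S \<nu> by unfold_locales (simp_all add: closed_operator_on_def resolvent_set_shift)
  have "drazin_invertible D ?S \<longleftrightarrow> b_fredholm D ?S"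
  proof (rule drazin_invertible_iff_b_fredholm[OF closed_S _ e(1)])
    show "\<nu> - \<mu> \<noteq> 0" using \<nu> \<mu> by (auto simp: spectrum_def)
    \<comment> \<open>Isolation of \<open>\<mu>\<close>, moved to the origin:
      \<open>\<kappa> + \<mu>\<close> is within \<open>e\<close> of \<open>\<mu>\<close> and
      different from it.\<close>
    show "\<kappa> \<in> resolvent_set D ?S" if "\<kappa> \<noteq> 0" "cmod \<kappa> < e" for \<kappa>
      using e(2)[of "\<kappa> + \<mu>"] that by (auto simp: resolvent_set_shift spectrum_def dist_norm)
  qed
  then show ?thesis
    using \<mu> by (simp add: b_discrete_spectrum_def drazin_spectrum_def)
qed

end
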